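(* Every (finite, connected) graph $\Sigma$, possibly having loops, multiple edges and free edges, is isomorphic to a monodromy graph $\mathrm{Mon}(G;U,\rho,\tau)$ for some group $G=\langle\rho,\tau\rangle$ with $\tau^2=1$ and some core-free subgroup $U$ of $G$.
   Context: Standing convention of the paper: graphs are connected and may have loops, multiple edges, and free edges (an edge with only one end, attached at a single vertex). A subgroup $U\le G$ is core-free if $\bigcap_{g\in G}g^{-1}Ug=1$. Monodromy graph: for $G=\langle\rho,\tau\rangle$ with $\tau^2=1$, $U$ core-free, $H=\langle\rho\rangle$, and $S$ a right transversal of $U$ in $G$, $\mathrm{Mon}(G;U,\rho,\tau)$ has vertex set $\{UgH\mid g\in G\}$, edge set $\{\{UhH,Uh\tau H\}\mid h\in S\}$, and for $h\in S$ the multiplicity of the edge between $UhH$ and $Uh\tau H$ is $|D|$ where $D=\{g\in S\mid g\in UhH \text{ and } g\tau\in Uh\tau H\}$; the edge is a free edge if $h\tau\in Uh$ and a loop if $h\tau\notin Uh$ but $h\tau\in UhH$.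
   Formalization: The graph is assumed to have at least one edge, since a single vertex without edges is not a monodromy graph (each has an edge because S is nonempty); loops and free edges of Mon are counted as orbits {Uh, Uhτ}, so a loop uses two elements of D. *)

theory Defs
  imports "HOL-Algebra.Coset" "HOL-Algebra.Generated_Groups" "HOL-Library.Multiset"
begin

section \<open>Graphs with loops, multiple edges and free edges\<close>

text \<open>
  The multiset \<open>ends \<Sigma> e\<close> lists the ends of the edge \<open>e\<close>: it is \<open>{#v#}\<close> for a free edge at \<open>v\<close>,
  \<open>{#v, v#}\<close> for a loop at \<open>v\<close>, and \<open>{#u, v#}\<close> with \<open>u \<noteq> v\<close> for an ordinary edge.
  Several edges may have the same ends.
\<close>

record ('v, 'e) graph =
  verts :: "'v set"
  edges :: "'e set"
  ends :: "'e \<Rightarrow> 'v multiset"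

definition wf_graph :: "('v, 'e) graph \<Rightarrow> bool" where
  "wf_graph \<Sigma> \<longleftrightarrow>
     (\<forall>e \<in> edges \<Sigma>. size (ends \<Sigma> e) \<in> {1, 2} \<and> set_mset (ends \<Sigma> e) \<subseteq> verts \<Sigma>)"

definition finite_graph :: "('v, 'e) graph \<Rightarrow> bool" where
  "finite_graph \<Sigma> \<longleftrightarrow> finite (verts \<Sigma>) \<and> finite (edges \<Sigma>)"

definition adjacency :: "('v, 'e) graph \<Rightarrow> ('v \<times> 'v) set" where
  "adjacency \<Sigma> = {(u, v). \<exists>e \<in> edges \<Sigma>. ends \<Sigma> e = {#u, v#}}"

definition connected_graph :: "('v, 'e) graph \<Rightarrow> bool" where
  "connected_graph \<Sigma> \<longleftrightarrow>
     verts \<Sigma> \<noteq> {} \<and> (\<forall>u \<in> verts \<Sigma>. \<forall>v \<in> verts \<Sigma>. (u, v) \<in> (adjacency \<Sigma>)\<^sup>*)"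

definition isomorphic_graphs :: "('v, 'e) graph \<Rightarrow> ('w, 'f) graph \<Rightarrow> bool" where
  "isomorphic_graphs \<Sigma> \<Sigma>' \<longleftrightarrow>
     (\<exists>\<phi> \<psi>. bij_betw \<phi> (verts \<Sigma>) (verts \<Sigma>') \<and> bij_betw \<psi> (edges \<Sigma>) (edges \<Sigma>') \<and>
        (\<forall>e \<in> edges \<Sigma>. ends \<Sigma>' (\<psi> e) = image_mset \<phi> (ends \<Sigma> e)))"


section \<open>Monodromy graphs\<close>

definition core_free :: "('a, 'b) monoid_scheme \<Rightarrow> 'a set \<Rightarrow> bool" where
  "core_free G U \<longleftrightarrow>
     (\<Inter>g \<in> carrier G. {inv\<^bsub>G\<^esub> g \<otimes>\<^bsub>G\<^esub> u \<otimes>\<^bsub>G\<^esub> g | u. u \<in> U}) = {\<one>\<^bsub>G\<^esub>}"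

definition right_transversal :: "('a, 'b) monoid_scheme \<Rightarrow> 'a set \<Rightarrow> 'a set \<Rightarrow> bool" where
  "right_transversal G U S \<longleftrightarrow>
     S \<subseteq> carrier G \<and> (\<forall>C \<in> rcosets\<^bsub>G\<^esub> U. \<exists>!s. s \<in> S \<and> s \<in> C)"

definition double_coset :: "('a, 'b) monoid_scheme \<Rightarrow> 'a set \<Rightarrow> 'a set \<Rightarrow> 'a \<Rightarrow> 'a set" where
  "double_coset G U H g = (U #>\<^bsub>G\<^esub> g) <#>\<^bsub>G\<^esub> H"

text \<open>
  The edge given by \<open>h\<close> joins \<open>UhH\<close> and \<open>Uh\<tau>H\<close>. To tell parallel edges apart, it is represented
  by the orbit \<open>{Uh, Uh\<tau>}\<close> of \<open>\<tau>\<close> on the right cosets of \<open>U\<close>, so that \<open>h\<close> and the representative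
  of \<open>Uh\<tau>\<close> give the same edge. Its ends are the double cosets of the members of that orbit. If the
  orbit is a single coset, i.e. \<open>h\<tau> \<in> Uh\<close>, there is only one end and the edge is free. The lemmas
  below show that this gives the multiplicities \<open>card D\<close>, where a loop counts twice (once for each
  of the cosets \<open>Uh\<close> and \<open>Uh\<tau>\<close>).
\<close>

definition mon_edge :: "('a, 'b) monoid_scheme \<Rightarrow> 'a set \<Rightarrow> 'a \<Rightarrow> 'a \<Rightarrow> 'a set set" where
  "mon_edge G U \<tau> h = {U #>\<^bsub>G\<^esub> h, U #>\<^bsub>G\<^esub> (h \<otimes>\<^bsub>G\<^esub> \<tau>)}"

definition mon_graph ::
  "('a, 'b) monoid_scheme \<Rightarrow> 'a set \<Rightarrow> 'a \<Rightarrow> 'a \<Rightarrow> 'a set \<Rightarrow> ('a set, 'a set set) graph" where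
  "mon_graph G U \<rho> \<tau> S =
     (let H = generate G {\<rho>} in
      \<lparr> verts = double_coset G U H ` carrier G,
        edges = mon_edge G U \<tau> ` S,
        ends = (\<lambda>e. image_mset (\<lambda>C. C <#>\<^bsub>G\<^esub> H) (mset_set e)) \<rparr>)"


section \<open>Properties of the encoding\<close>

lemma pair_mset_eq: "{#a, b#} = {#c, d#} \<longleftrightarrow> a = c \<and> b = d \<or> a = d \<and> b = c"
  by (auto simp: add_eq_conv_ex)

locale mon_setup = group G for G :: "('a, 'b) monoid_scheme" (structure) +
  fixes U S :: "'a set" and \<rho> \<tau> :: 'a
  assumes U: "subgroup U G" and \<rho>: "\<rho> \<in> carrier G" and \<tau>: "\<tau> \<in> carrier G"
    and \<tau>\<tau>: "\<tau> \<otimes> \<tau> = \<one>" and S: "right_transversal G U S"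
begin

abbreviation "H \<equiv> generate G {\<rho>}"
abbreviation "dc \<equiv> double_coset G U H"
abbreviation "M \<equiv> mon_graph G U \<rho> \<tau> S"

lemma H: "subgroup H G"
  by (intro generate_is_subgroup) (use \<rho> in auto)

lemma S_carrier: "g \<in> S \<Longrightarrow> g \<in> carrier G"
  using S by (auto simp: right_transversal_def)

lemma coset_eq_iff: "g \<in> carrier G \<Longrightarrow> h \<in> carrier G \<Longrightarrow> U #> g = U #> h \<longleftrightarrow> g \<in> U #> h"
  using repr_independence[OF _ _ U, of g h] rcos_self[OF _ U, of g] by metis

lemma U_carrier: "U \<subseteq> carrier G"
  using subgroup.subset[OF U] .

lemma S_ex1: assumes "g \<in> carrier G" shows "\<exists>!s. s \<in> S \<and> s \<in> U #> g"
  using S rcosetsI[OF U_carrier assms] unfolding right_transversal_def by blast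

lemma S_inj:
  assumes "g \<in> S" "h \<in> S" "U #> g = U #> h"
  shows "g = h"
proof -
  have "g \<in> U #> h" "h \<in> U #> h"
    using assms rcos_self[OF _ U] S_carrier by metis+
  then show ?thesis using S_ex1[of h] assms S_carrier by blast
qed

lemma S_rep:
  assumes "g \<in> carrier G"
  obtains s where "s \<in> S" "U #> s = U #> g"
proof -
  obtain s where s: "s \<in> S" "s \<in> U #> g" using S_ex1[OF assms] by blast
  then have "U #> s = U #> g" using coset_eq_iff[OF S_carrier[OF s(1)] assms] by simp
  then show ?thesis using s that by blast
qed

lemma coset_mult_\<tau>: "g \<in> carrier G \<Longrightarrow> U #> (g \<otimes> \<tau>) = (U #> g) #> \<tau>"
  using coset_mult_assoc[OF U_carrier _ \<tau>] by simp

lemma coset_\<tau>':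
  "g \<in> carrier G \<Longrightarrow> h \<in> carrier G \<Longrightarrow> U #> g = U #> h \<Longrightarrow> U #> (g \<otimes> \<tau>) = U #> (h \<otimes> \<tau>)"
  by (simp add: coset_mult_\<tau>)

lemma coset_\<tau>:
  assumes "g \<in> carrier G" "h \<in> carrier G" "U #> g = U #> (h \<otimes> \<tau>)"
  shows "U #> (g \<otimes> \<tau>) = U #> h"
proof -
  have "U #> (g \<otimes> \<tau>) = U #> (h \<otimes> \<tau> \<otimes> \<tau>)"
    using coset_\<tau>'[OF assms(1) _ assms(3)] assms(2) \<tau> by simp
  then show ?thesis using assms \<tau> \<tau>\<tau> by (simp add: m_assoc)
qed

lemma dc_cong: "U #> g = U #> h \<Longrightarrow> dc g = dc h"
  by (simp add: double_coset_def)

lemma dc_self: "g \<in> carrier G \<Longrightarrow> g \<in> dc g"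
  unfolding double_coset_def set_mult_def
  using rcos_self[OF _ U] subgroup.one_closed[OF H] r_one by fastforce

lemma dc_eq_iff:
  assumes "g \<in> carrier G" "h \<in> carrier G"
  shows "g \<in> dc h \<longleftrightarrow> dc g = dc h"
proof
  assume "g \<in> dc h"
  then obtain x k where xk: "x \<in> U #> h" "k \<in> H" "g = x \<otimes> k"
    by (auto simp: double_coset_def set_mult_def)
  have x: "x \<in> carrier G" using xk(1) r_coset_subset_G[OF U_carrier assms(2)] by blast
  have k: "k \<in> carrier G" using subgroup.mem_carrier[OF H xk(2)] .
  have "U #> g = (U #> h) #> k"
    using xk coset_mult_assoc[OF U_carrier x k] coset_eq_iff[OF x assms(2)] by simp
  then have "dc g = (U #> h) <#> l_coset G k H"
    unfolding double_coset_def
    using rcos_assoc_lcos[OF r_coset_subset_G[OF U_carrier assms(2)] subgroup.subset[OF H] k]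
    by simp
  also have "l_coset G k H = H" using coset_join3[OF k H xk(2)] .
  finally show "dc g = dc h" by (simp add: double_coset_def)
qed (use dc_self[OF assms(1)] in simp)

lemma edges_eq: "edges M = mon_edge G U \<tau> ` carrier G"
proof -
  have "mon_edge G U \<tau> g \<in> mon_edge G U \<tau> ` S" if g: "g \<in> carrier G" for g
  proof -
    obtain s where s: "s \<in> S" "U #> s = U #> g" using S_rep[OF g] .
    then have "mon_edge G U \<tau> s = mon_edge G U \<tau> g"
      using coset_\<tau>'[OF _ g] S_carrier by (simp add: mon_edge_def)
    then show ?thesis using s by (metis imageI)
  qed
  then show ?thesis using S_carrier by (auto simp: mon_graph_def Let_def)
qed

text \<open>A monodromy graph is never the one-vertex graph without edges.\<close>

lemma edges_nonempty: "edges M \<noteq> {}"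
  unfolding edges_eq using one_closed by blast

text \<open>The graph does not depend on the transversal.\<close>

lemma mon_graph_indep:
  assumes "right_transversal G U S'"
  shows "mon_graph G U \<rho> \<tau> S' = M"
proof -
  interpret S': mon_setup G U S' \<rho> \<tau>
    by (intro mon_setup.intro mon_setup_axioms.intro is_group U \<rho> \<tau> \<tau>\<tau> assms)
  show ?thesis using edges_eq S'.edges_eq by (simp add: mon_graph_def Let_def)
qed

lemma ends_mon_edge:
  assumes "h \<in> carrier G"
  shows "ends M (mon_edge G U \<tau> h) =
           (if h \<otimes> \<tau> \<in> U #> h then {#dc h#} else {#dc h, dc (h \<otimes> \<tau>)#})"
proof -
  have "h \<otimes> \<tau> \<in> U #> h \<longleftrightarrow> U #> (h \<otimes> \<tau>) = U #> h"
    using coset_eq_iff assms \<tau> by blast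
  moreover have ends: "ends M e = image_mset (\<lambda>C. C <#> H) (mset_set e)" for e
    unfolding mon_graph_def Let_def by simp
  have "ends M (mon_edge G U \<tau> h) = {#dc h#}" if "U #> (h \<otimes> \<tau>) = U #> h"
    unfolding ends mon_edge_def that double_coset_def by simp
  moreover have "ends M (mon_edge G U \<tau> h) = {#dc h, dc (h \<otimes> \<tau>)#}"
    if ne: "U #> (h \<otimes> \<tau>) \<noteq> U #> h"
  proof -
    have "mset_set {U #> h, U #> (h \<otimes> \<tau>)} = {#U #> h, U #> (h \<otimes> \<tau>)#}"
      using ne by (subst mset_set.insert) auto
    then show ?thesis unfolding ends mon_edge_def double_coset_def by simp
  qed
  ultimately show ?thesis by presburger
qed

lemma links_multiplicity:
  assumes h: "h \<in> carrier G" and ne: "dc h \<noteq> dc (h \<otimes> \<tau>)"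
  defines "D \<equiv> {g \<in> S. g \<in> dc h \<and> g \<otimes> \<tau> \<in> dc (h \<otimes> \<tau>)}"
  shows "card {e \<in> edges M. ends M e = {#dc h, dc (h \<otimes> \<tau>)#}} = card D"
proof -
  have D: "D = {g \<in> S. dc g = dc h \<and> dc (g \<otimes> \<tau>) = dc (h \<otimes> \<tau>)}"
    unfolding D_def using dc_eq_iff[OF S_carrier h] dc_eq_iff[OF m_closed[OF S_carrier \<tau>] m_closed[OF h \<tau>]]
    by (intro Collect_cong) meson
  have free: "dc (g \<otimes> \<tau>) = dc g" if "g \<in> carrier G" "g \<otimes> \<tau> \<in> U #> g" for g
    using that coset_eq_iff[OF m_closed[OF that(1) \<tau>] that(1)] dc_cong[of "g \<otimes> \<tau>" g] by blast
  have "bij_betw (mon_edge G U \<tau>) D {e \<in> edges M. ends M e = {#dc h, dc (h \<otimes> \<tau>)#}}"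
  proof (rule bij_betwI')
    fix g g' assume *: "g \<in> D" "g' \<in> D"
    show "mon_edge G U \<tau> g = mon_edge G U \<tau> g' \<longleftrightarrow> g = g'"
    proof
      assume "mon_edge G U \<tau> g = mon_edge G U \<tau> g'"
      then have "U #> g = U #> g' \<or> U #> g = U #> (g' \<otimes> \<tau>)"
        unfolding mon_edge_def by blast
      moreover have "U #> g \<noteq> U #> (g' \<otimes> \<tau>)"
        using * ne dc_cong[of g "g' \<otimes> \<tau>"] unfolding D by force
      ultimately show "g = g'" using * S_inj[of g g'] unfolding D by blast
    qed simp
  next
    fix g assume "g \<in> D"
    then have g: "g \<in> S" "dc g = dc h" "dc (g \<otimes> \<tau>) = dc (h \<otimes> \<tau>)" unfolding D by blast+
    then have "g \<otimes> \<tau> \<notin> U #> g" using free[OF S_carrier] ne by metis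
    moreover have "mon_edge G U \<tau> g \<in> edges M"
      unfolding edges_eq using S_carrier[OF g(1)] by (rule imageI)
    ultimately show "mon_edge G U \<tau> g \<in> {e \<in> edges M. ends M e = {#dc h, dc (h \<otimes> \<tau>)#}}"
      using g(2,3) ends_mon_edge[OF S_carrier[OF g(1)]] by simp
  next
    fix e assume e: "e \<in> {e \<in> edges M. ends M e = {#dc h, dc (h \<otimes> \<tau>)#}}"
    then obtain g where g: "g \<in> S" "e = mon_edge G U \<tau> g"
      unfolding mon_graph_def Let_def by auto
    have gc: "g \<in> carrier G" using g S_carrier by simp
    have ends: "ends M (mon_edge G U \<tau> g) = {#dc h, dc (h \<otimes> \<tau>)#}" using e g by blast
    have "g \<otimes> \<tau> \<notin> U #> g"
    proof
      assume "g \<otimes> \<tau> \<in> U #> g"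
      then have "ends M (mon_edge G U \<tau> g) = {#dc g#}" using ends_mon_edge[OF gc] by simp
      then show False using ends by simp
    qed
    then have "ends M (mon_edge G U \<tau> g) = {#dc g, dc (g \<otimes> \<tau>)#}"
      using ends_mon_edge[OF gc] by simp
    then have "{#dc g, dc (g \<otimes> \<tau>)#} = {#dc h, dc (h \<otimes> \<tau>)#}"
      using ends by (rule trans[OF sym])
    then consider "dc g = dc h" "dc (g \<otimes> \<tau>) = dc (h \<otimes> \<tau>)"
      | "dc g = dc (h \<otimes> \<tau>)" "dc (g \<otimes> \<tau>) = dc h"
      unfolding pair_mset_eq by blast
    then show "\<exists>x\<in>D. e = mon_edge G U \<tau> x"
    proof cases
      case 1 then show ?thesis using g unfolding D by blast
    next
      case 2
      obtain s where s: "s \<in> S" "U #> s = U #> (g \<otimes> \<tau>)" using S_rep[OF m_closed[OF gc \<tau>]] .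
      have s': "U #> (s \<otimes> \<tau>) = U #> g" using coset_\<tau>[OF S_carrier[OF s(1)] gc s(2)] .
      have "s \<in> D" unfolding D using s(1) trans[OF dc_cong[OF s(2)] 2(2)] trans[OF dc_cong[OF s'] 2(1)] by blast
      moreover have "e = mon_edge G U \<tau> s" unfolding g(2) mon_edge_def s(2) s' by blast
      ultimately show ?thesis by blast
    qed
  qed
  then show ?thesis by (rule bij_betw_same_card[symmetric])
qed

lemma loops_multiplicity:
  assumes fin: "finite S" and h: "h \<in> carrier G" and eq: "dc h = dc (h \<otimes> \<tau>)"
  defines "D \<equiv> {g \<in> S. g \<in> dc h \<and> g \<otimes> \<tau> \<in> dc (h \<otimes> \<tau>)}"
  shows "card D = card {e \<in> edges M. ends M e = {#dc h#}}
                  + 2 * card {e \<in> edges M. ends M e = {#dc h, dc h#}}"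
proof -
  let ?F = "{e \<in> edges M. ends M e = {#dc h#}}"
  let ?L = "{e \<in> edges M. ends M e = {#dc h, dc h#}}"
  have D: "D = {g \<in> S. dc g = dc h \<and> dc (g \<otimes> \<tau>) = dc h}"
    unfolding D_def using dc_eq_iff[OF S_carrier h] dc_eq_iff[OF m_closed[OF S_carrier \<tau>] m_closed[OF h \<tau>]]
    by (intro Collect_cong) (metis eq)
  have finE: "finite (edges M)" using fin by (simp add: mon_graph_def Let_def)
  have Un: "(\<Union>e \<in> ?F \<union> ?L. e) = (\<lambda>g. U #> g) ` D"
  proof (intro equalityI subsetI)
    fix C assume "C \<in> (\<Union>e \<in> ?F \<union> ?L. e)"
    then obtain e where e: "C \<in> e" "e \<in> ?F \<union> ?L" by blast
    then have "e \<in> edges M" by blast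
    then obtain g where gc: "g \<in> carrier G" and g: "e = mon_edge G U \<tau> g"
      unfolding edges_eq by blast
    have "set_mset (ends M e) \<subseteq> {dc h}" using e(2) by auto
    moreover have "set_mset (ends M e) = {dc g, dc (g \<otimes> \<tau>)}"
    proof (cases "g \<otimes> \<tau> \<in> U #> g")
      case True
      have "dc (g \<otimes> \<tau>) = dc g"
        using True coset_eq_iff[OF m_closed[OF gc \<tau>] gc] dc_cong by blast
      then show ?thesis unfolding g ends_mon_edge[OF gc] using True by simp
    next
      case False
      then show ?thesis unfolding g ends_mon_edge[OF gc] by simp
    qed
    ultimately have gd: "dc g = dc h \<and> dc (g \<otimes> \<tau>) = dc h" by blast
    show "C \<in> (\<lambda>g. U #> g) ` D"
    proof (cases "C = U #> g")
      case True
      obtain s where s: "s \<in> S" "U #> s = U #> g" using S_rep[OF gc] .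
      have s': "U #> (s \<otimes> \<tau>) = U #> (g \<otimes> \<tau>)" using coset_\<tau>'[OF S_carrier[OF s(1)] gc s(2)] .
      have "s \<in> D"
        unfolding D using s(1) trans[OF dc_cong[OF s(2)] conjunct1[OF gd]]
          trans[OF dc_cong[OF s'] conjunct2[OF gd]] by blast
      then show ?thesis unfolding True s(2)[symmetric] by (rule imageI)
    next
      case False
      then have C: "C = U #> (g \<otimes> \<tau>)" using e(1) unfolding g mon_edge_def by blast
      obtain s where s: "s \<in> S" "U #> s = U #> (g \<otimes> \<tau>)" using S_rep[OF m_closed[OF gc \<tau>]] .
      have s': "U #> (s \<otimes> \<tau>) = U #> g" using coset_\<tau>[OF S_carrier[OF s(1)] gc s(2)] .
      have "s \<in> D"
        unfolding D using s(1) trans[OF dc_cong[OF s(2)] conjunct2[OF gd]]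
          trans[OF dc_cong[OF s'] conjunct1[OF gd]] by blast
      then show ?thesis unfolding C s(2)[symmetric] by (rule imageI)
    qed
  next
    fix C assume "C \<in> (\<lambda>g. U #> g) ` D"
    then obtain g where g: "g \<in> D" "C = U #> g" by blast
    have gc: "g \<in> carrier G" using g(1) S_carrier unfolding D by blast
    have "mon_edge G U \<tau> g \<in> edges M" unfolding edges_eq using gc by (rule imageI)
    moreover have "dc g = dc h" "dc (g \<otimes> \<tau>) = dc h" using g(1) unfolding D by blast+
    ultimately have "mon_edge G U \<tau> g \<in> ?F \<union> ?L"
      using ends_mon_edge[OF gc] by (cases "g \<otimes> \<tau> \<in> U #> g") simp_all
    moreover have "C \<in> mon_edge G U \<tau> g" unfolding g(2) mon_edge_def by blast
    ultimately show "C \<in> (\<Union>e \<in> ?F \<union> ?L. e)" by blast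
  qed
  have size: "card e = size (ends M e)" for e
    unfolding mon_graph_def Let_def by simp
  have disj: "e \<inter> e' = {}" if ee: "e \<in> edges M" "e' \<in> edges M" "e \<noteq> e'" for e e'
  proof (rule ccontr)
    assume *: "e \<inter> e' \<noteq> {}"
    have eq: "e = mon_edge G U \<tau> g" if eg: "e \<in> edges M" "U #> g \<in> e" "g \<in> carrier G" for e g
    proof -
      obtain k where k: "k \<in> carrier G" "e = mon_edge G U \<tau> k" using eg(1) unfolding edges_eq by blast
      then consider "U #> g = U #> k" | "U #> g = U #> (k \<otimes> \<tau>)"
        using eg(2) unfolding k(2) mon_edge_def by blast
      then show ?thesis
      proof cases
        case 1
        show ?thesis unfolding k(2) mon_edge_def 1 coset_\<tau>'[OF eg(3) k(1) 1] by (rule refl)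
      next
        case 2
        show ?thesis unfolding k(2) mon_edge_def 2 coset_\<tau>[OF eg(3) k(1) 2] by (rule insert_commute)
      qed
    qed
    obtain C k where C: "C \<in> e" "C \<in> e'" "k \<in> carrier G" "e = mon_edge G U \<tau> k"
      using * ee(1) unfolding edges_eq by blast
    have "C = U #> k \<or> C = U #> (k \<otimes> \<tau>)" using C(1) unfolding C(4) mon_edge_def by blast
    then obtain g where g: "g \<in> carrier G" "C = U #> g"
      using C(3) m_closed[OF C(3) \<tau>] by blast
    have "e = e'"
      using eq[OF ee(1) C(1)[unfolded g(2)] g(1)] eq[OF ee(2) C(2)[unfolded g(2)] g(1)]
      by (rule trans[OF _ sym])
    then show False using ee(3) by contradiction
  qed
  have finm: "finite e" if "e \<in> edges M" for e
    using that by (auto simp: mon_graph_def Let_def mon_edge_def)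
  have "card D = card ((\<lambda>g. U #> g) ` D)"
    by (rule card_image[symmetric]) (auto simp: inj_on_def D intro: S_inj)
  also have "\<dots> = (\<Sum>e \<in> ?F \<union> ?L. card e)"
    unfolding Un[symmetric] by (rule card_UN_disjoint) (use finE finm disj in auto)
  also have "\<dots> = (\<Sum>e \<in> ?F. card e) + (\<Sum>e \<in> ?L. card e)"
    by (rule sum.union_disjoint) (use finE in auto)
  also have "(\<Sum>e \<in> ?F. card e) = card ?F" using size by simp
  also have "(\<Sum>e \<in> ?L. card e) = 2 * card ?L" using size by simp
  finally show ?thesis .
qed

end

end

theory Submission
  imports Defs "HOL-Combinatorics.Permutations"
begin

text \<open>
  Cut every edge into its ends, called darts, so that a free edge has one dart and every other edge
  has two. Let \<open>\<tau>\<close> swap the two darts of each edge (and fix the dart of a free edge), and let \<open>\<rho>\<close>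
  permute the darts at each vertex cyclically. As the graph is connected and has an edge, every
  vertex carries a dart and \<open>G = \<langle>\<rho>, \<tau>\<rangle>\<close> acts transitively on the darts. With \<open>U\<close> the stabiliser of a
  dart, which is core-free because \<open>G\<close> acts faithfully, the right cosets of \<open>U\<close> are the darts, the
  double cosets of \<open>U\<close> and \<open>\<langle>\<rho>\<rangle>\<close> are the vertices, and the \<open>\<tau>\<close>-orbits of cosets are the edges.
\<close>

section \<open>Permutations cycling the fibres of a map\<close>

text \<open>Each fibre is enumerated by \<open>b x\<close>, and \<rho> raises the index by one
  modulo the size of the fibre. With the vertex map this gives the rotation at the vertices, with
  the edge map the swap of the darts of an edge.\<close>

lemma cyclic_permutation_of_fibres:
  fixes f :: "'d \<Rightarrow> 'x"
  assumes fin: "finite D"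
  obtains \<rho> where "\<rho> permutes D"
    and "\<And>d. d \<in> D \<Longrightarrow> range (\<lambda>k. (\<rho> ^^ k) d) = {d' \<in> D. f d' = f d}"
proof -
  define F c where "F x = {d \<in> D. f d = x}" and "c x = card (F x)" for x
  have "\<exists>b. bij_betw b {0..<c x} (F x)" for x
    using ex_bij_betw_nat_finite[of "F x"] fin by (simp add: F_def c_def)
  then obtain b where b: "\<And>x. bij_betw (b x) {0..<c x} (F x)" by metis
  define \<rho> where
    "\<rho> d = (if d \<in> D then b (f d) (Suc (inv_into {0..<c (f d)} (b (f d)) d) mod c (f d)) else d)" for d
  have bF: "b x i \<in> D" "f (b x i) = x" if "i < c x" for x i
    using bij_betw_apply[OF b[of x], of i] that by (auto simp: F_def)
  have rep: "\<exists>i < c (f d). b (f d) i = d" if "d \<in> D" for d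
    using b[of "f d"] that by (force simp: bij_betw_def F_def image_iff)
  have step: "\<rho> (b x i) = b x (Suc i mod c x)" if "i < c x" for x i
    using bF[OF that] that bij_betw_inv_into_left[OF b[of x], of i] by (simp add: \<rho>_def)
  have power: "(\<rho> ^^ k) (b x i) = b x ((i + k) mod c x)" if "i < c x" for x i k
  proof (induction k)
    case (Suc k)
    have "(i + k) mod c x < c x" using that by simp
    then show ?case using Suc step by (simp add: mod_Suc_eq)
  qed (use that in simp)
  have orbit: "range (\<lambda>k. (\<rho> ^^ k) d) = {d' \<in> D. f d' = f d}" if d: "d \<in> D" for d
  proof -
    obtain i where i: "i < c (f d)" "b (f d) i = d" using rep[OF d] by blast
    have eq: "(\<rho> ^^ k) d = b (f d) ((i + k) mod c (f d))" for k using power[OF i(1), of k] i(2) by simp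
    have "d' \<in> range (\<lambda>k. (\<rho> ^^ k) d)" if d': "d' \<in> D" "f d' = f d" for d'
    proof -
      obtain j where j: "j < c (f d)" "b (f d) j = d'" using rep[OF d'(1)] d'(2) by auto
      \<comment> \<open>Going forward from i past the end of the enumeration avoids the difference j
        - i, which truncates to zero for j < i.\<close>
      have "(i + (c (f d) - i + j)) mod c (f d) = j" using i(1) j(1) by simp
      then show ?thesis using eq[of "c (f d) - i + j"] j(2) by (metis rangeI)
    qed
    moreover have "(\<rho> ^^ k) d \<in> D \<and> f ((\<rho> ^^ k) d) = f d" for k
      using bF[of "(i + k) mod c (f d)" "f d"] i(1) unfolding eq by simp
    ultimately show ?thesis by blast
  qed
  \<comment> \<open>Since d lies in the fibre of \<rho> d, some power of \<rho> takes \<rho> d back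
    to d; the same power applied to d is a preimage of d. Finiteness turns surjectivity into
    injectivity.\<close>
  have "D \<subseteq> \<rho> ` D"
  proof
    fix d assume d: "d \<in> D"
    then have "\<rho> d \<in> D" using orbit[OF d] rangeI[of "\<lambda>k. (\<rho> ^^ k) d" 1] by simp
    moreover have "d \<in> range (\<lambda>k. (\<rho> ^^ k) (\<rho> d))"
      using orbit[OF d] orbit[OF \<open>\<rho> d \<in> D\<close>] rangeI[of "\<lambda>k. (\<rho> ^^ k) d" 1] d by simp
    then obtain k where k: "d = (\<rho> ^^ k) (\<rho> d)" by blast
    moreover have "(\<rho> ^^ k) d \<in> D" using orbit[OF d] rangeI[of "\<lambda>k. (\<rho> ^^ k) d" k] by simp
    ultimately show "d \<in> \<rho> ` D" by (metis funpow_swap1 imageI)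
  qed
  moreover have "\<rho> ` D \<subseteq> D" using orbit rangeI[of "\<lambda>k. (\<rho> ^^ k) _" 1] by fastforce
  ultimately have "\<rho> permutes D"
    using fin by (intro bij_imp_permutes) (auto simp: bij_betw_def \<rho>_def eq_card_imp_inj_on)
  then show ?thesis using orbit that by blast
qed

section \<open>Permutation groups acting from the right\<close>

abbreviation inv' :: "('d \<Rightarrow> 'd) \<Rightarrow> 'd \<Rightarrow> 'd" where "inv' p \<equiv> Hilbert_Choice.inv p"

text \<open>Products are composed from left to right, so that right cosets of a point stabiliser
  correspond to points.\<close>

definition perm_group :: "'d set \<Rightarrow> ('d \<Rightarrow> 'd) monoid" where
  "perm_group D = \<lparr>carrier = {p. p permutes D}, monoid.mult = (\<lambda>p q. q \<circ> p), one = id\<rparr>"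

lemma perm_group_simps [simp]:
  "carrier (perm_group D) = {p. p permutes D}"
  "p \<otimes>\<^bsub>perm_group D\<^esub> q = q \<circ> p"
  "\<one>\<^bsub>perm_group D\<^esub> = id"
  by (simp_all add: perm_group_def)

lemma group_perm_group: "group (perm_group D)"
proof (rule groupI)
  fix p assume "p \<in> carrier (perm_group D)"
  then show "\<exists>q \<in> carrier (perm_group D). q \<otimes>\<^bsub>perm_group D\<^esub> p = \<one>\<^bsub>perm_group D\<^esub>"
    using permutes_inv[of p D] permutes_inv_o[of p D] by auto
qed (auto simp: permutes_compose permutes_id)

lemma inv_perm_group:
  assumes "p permutes D" shows "inv\<^bsub>perm_group D\<^esub> p = inv' p"
  using group.inv_equality[OF group_perm_group, of D "inv' p" p] assms permutes_inv[OF assms]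
    permutes_inv_o[OF assms] by simp

text \<open>Choosing a member of every right coset works because distinct cosets are
  disjoint.\<close>

lemma (in group) ex_right_transversal:
  assumes "subgroup U G" shows "\<exists>S. right_transversal G U S"
proof -
  let ?S = "(\<lambda>C. SOME g. g \<in> C) ` (rcosets U)"
  have rep: "(SOME g. g \<in> C) \<in> C" if "C \<in> rcosets U" for C
  proof -
    obtain a where a: "a \<in> carrier G" "C = U #> a" using \<open>C \<in> rcosets U\<close> by (auto simp: RCOSETS_def)
    then have "a \<in> C" using rcos_self[OF _ assms] by blast
    then show ?thesis by (rule someI)
  qed
  have sub: "C \<subseteq> carrier G" if "C \<in> rcosets U" for C
    using that rcosets_part_G[OF assms] by blast
  have "\<exists>!s. s \<in> ?S \<and> s \<in> C" if C: "C \<in> rcosets U" for C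
  proof (rule ex1I[of _ "SOME g. g \<in> C"])
    show "(SOME g. g \<in> C) \<in> ?S \<and> (SOME g. g \<in> C) \<in> C" using C rep by blast
    fix s assume s: "s \<in> ?S \<and> s \<in> C"
    then obtain C' where C': "C' \<in> rcosets U" "s = (SOME g. g \<in> C')" by blast
    then have "s \<in> C' \<inter> C" using rep s by blast
    then have "C' = C" using rcos_disjoint[OF assms] C' C unfolding pairwise_def disjnt_def by blast
    then show "s = (SOME g. g \<in> C)" using C' by simp
  qed
  moreover have "?S \<subseteq> carrier G" using rep sub by blast
  ultimately have "right_transversal G U ?S" by (simp add: right_transversal_def)
  then show ?thesis ..
qed

section \<open>The monodromy graph of a system of darts\<close>

text \<open>The interface between graph and group: only the orbits of the two permutations are
  recorded. Transitivity is an induction principle over sets closed under both, the form in which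
  connectedness supplies it.\<close>

locale dart_system =
  fixes D :: "'d set" and \<rho> \<tau> :: "'d \<Rightarrow> 'd" and d\<^sub>0 :: 'd and vt :: "'d \<Rightarrow> 'v" and eg :: "'d \<Rightarrow> 'e"
  assumes \<rho>: "\<rho> permutes D" and \<tau>: "\<tau> permutes D" and \<tau>\<tau>: "\<tau> \<circ> \<tau> = id" and d\<^sub>0: "d\<^sub>0 \<in> D"
    and \<rho>_orbit: "d \<in> D \<Longrightarrow> range (\<lambda>k. (\<rho> ^^ k) d) = {d' \<in> D. vt d' = vt d}"
    and \<tau>_orbit: "d \<in> D \<Longrightarrow> {d, \<tau> d} = {d' \<in> D. eg d' = eg d}"
    and transitive: "d\<^sub>0 \<in> X \<Longrightarrow> (\<And>d. d \<in> X \<Longrightarrow> \<rho> d \<in> X \<and> \<tau> d \<in> X) \<Longrightarrow> D \<subseteq> X"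
begin

section \<open>The group acting on the darts and the stabiliser of a base dart\<close>

definition G :: "('d \<Rightarrow> 'd) monoid" where
  "G = perm_group D \<lparr>carrier := generate (perm_group D) {\<rho>, \<tau>}\<rparr>"

definition U :: "('d \<Rightarrow> 'd) set" where
  "U = {g \<in> carrier G. g d\<^sub>0 = d\<^sub>0}"

definition C :: "'d \<Rightarrow> ('d \<Rightarrow> 'd) set" where
  "C d = {g \<in> carrier G. g d\<^sub>0 = d}"

text \<open>Serves as the double coset of \<open>U\<close> and \<open>H\<close> that stands for the
  vertex \<open>v\<close>, as \<open>C d\<close> is the right coset that stands for the dart
  \<open>d\<close>.\<close>

definition \<phi> :: "'v \<Rightarrow> ('d \<Rightarrow> 'd) set" where
  "\<phi> v = {g \<in> carrier G. vt (g d\<^sub>0) = v}"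

abbreviation "H \<equiv> generate G {\<rho>}"

lemma gens: "{\<rho>, \<tau>} \<subseteq> carrier (perm_group D)" "\<rho> \<in> carrier G" "\<tau> \<in> carrier G"
  using \<rho> \<tau> by (auto simp: G_def intro: generate.incl)

lemma subgroup_G: "subgroup (carrier G) (perm_group D)"
  unfolding G_def using group.generate_is_subgroup[OF group_perm_group gens(1)] by simp

lemma group_G: "group G"
  using group.subgroup_imp_group[OF group_perm_group subgroup_G] by (simp add: G_def)

lemma G_simps [simp]: "p \<otimes>\<^bsub>G\<^esub> q = q \<circ> p" "\<one>\<^bsub>G\<^esub> = id"
  by (simp_all add: G_def)

lemma G_permutes: "g \<in> carrier G \<Longrightarrow> g permutes D"
  using subgroup.subset[OF subgroup_G] by auto

lemma inv_G: "g \<in> carrier G \<Longrightarrow> inv\<^bsub>G\<^esub> g = inv' g"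
  using group.m_inv_consistent[OF group_perm_group subgroup_G] inv_perm_group[OF G_permutes]
  by (simp add: G_def)

text \<open>Generation was taken in the full permutation group; as \<open>carrier G\<close> is a
  subgroup, generating inside \<open>G\<close> gives the same set.\<close>

lemma carrier_G: "carrier G = generate G {\<rho>, \<tau>}"
proof -
  have "{\<rho>, \<tau>} \<subseteq> carrier G" using gens by simp
  from group.generate_consistent[OF group_perm_group this subgroup_G]
  show ?thesis by (simp add: G_def)
qed

lemma comp_closed: "g \<in> carrier G \<Longrightarrow> h \<in> carrier G \<Longrightarrow> h \<circ> g \<in> carrier G"
  using monoid.m_closed[OF group.is_monoid[OF group_G], of g h] by simp

lemma inv_closed: "g \<in> carrier G \<Longrightarrow> inv' g \<in> carrier G"
  using group.inv_closed[OF group_G, of g] inv_G by simp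

text \<open>Following a group element by a generator applies that generator to the image of
  \<open>d\<^sub>0\<close>, so the orbit of \<open>d\<^sub>0\<close> is closed under \<rho> and
  \<tau> and \<open>transitive\<close> applies.\<close>

lemma G_transitive:
  assumes "d \<in> D" obtains g where "g \<in> carrier G" "g d\<^sub>0 = d"
proof -
  let ?X = "(\<lambda>g. g d\<^sub>0) ` carrier G"
  have "id \<in> carrier G" using monoid.one_closed[OF group.is_monoid[OF group_G]] by simp
  then have "d\<^sub>0 \<in> ?X" using imageI[of id _ "\<lambda>g. g d\<^sub>0"] by simp
  moreover have "\<rho> d \<in> ?X \<and> \<tau> d \<in> ?X" if d: "d \<in> ?X" for d
  proof -
    obtain g where g: "g \<in> carrier G" "d = g d\<^sub>0" using d by blast
    have "\<rho> \<circ> g \<in> carrier G" "\<tau> \<circ> g \<in> carrier G" using comp_closed[OF g(1)] gens by blast+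
    from this[THEN imageI[of _ _ "\<lambda>g. g d\<^sub>0"]] show ?thesis by (simp add: g(2))
  qed
  ultimately have "D \<subseteq> ?X" by (rule transitive)
  then have "d \<in> ?X" using assms by blast
  then show ?thesis using that by (elim imageE) simp
qed

lemma subgroup_U: "subgroup U G"
proof (rule group.subgroupI[OF group_G])
  show "U \<noteq> {}"
    using monoid.one_closed[OF group.is_monoid[OF group_G]] by (auto simp: U_def)
  fix g assume g: "g \<in> U"
  then have gG: "g \<in> carrier G" "g d\<^sub>0 = d\<^sub>0" by (simp_all add: U_def)
  then have "inv' g d\<^sub>0 = d\<^sub>0" using permutes_inverses(2)[OF G_permutes[OF gG(1)], of "d\<^sub>0"] by simp
  then show "inv\<^bsub>G\<^esub> g \<in> U" using inv_G[OF gG(1)] inv_closed[OF gG(1)] by (simp add: U_def)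
  fix h assume "h \<in> U"
  then show "g \<otimes>\<^bsub>G\<^esub> h \<in> U" using g comp_closed by (simp add: U_def)
qed (auto simp: U_def)

text \<open>Conjugating the stabiliser of \<open>d\<^sub>0\<close> by an element that takes
  \<open>d\<^sub>0\<close> to d gives the stabiliser of d. By transitivity, a member of all
  conjugates fixes every dart.\<close>

lemma core_free_U: "core_free G U"
proof -
  let ?K = "\<lambda>g. {inv\<^bsub>G\<^esub> g \<otimes>\<^bsub>G\<^esub> u \<otimes>\<^bsub>G\<^esub> g | u. u \<in> U}"
  have "x = id" if x: "x \<in> (\<Inter>g \<in> carrier G. ?K g)" for x
  proof
    fix d
    show "x d = id d"
    proof (cases "d \<in> D")
      case True
      then obtain g where g: "g \<in> carrier G" "g d\<^sub>0 = d" using G_transitive by blast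
      then obtain u where u: "u \<in> U" "x = g \<circ> (u \<circ> inv' g)" using x inv_G[of g] by force
      have "inv' g d = d\<^sub>0" using g permutes_inverses(2)[OF G_permutes[OF g(1)]] by metis
      then show ?thesis using u g by (simp add: U_def)
    next
      case False
      \<comment> \<open>Off \<open>D\<close>, conjugation by the identity shows that x lies in
        \<open>U\<close>; hence x permutes \<open>D\<close> and fixes d.\<close>
      obtain u where u: "u \<in> U" "x = inv\<^bsub>G\<^esub> \<one>\<^bsub>G\<^esub> \<otimes>\<^bsub>G\<^esub> u \<otimes>\<^bsub>G\<^esub> \<one>\<^bsub>G\<^esub>"
        using x monoid.one_closed[OF group.is_monoid[OF group_G]] by blast
      then have "x = u" using monoid.inv_one[OF group.is_monoid[OF group_G]] by simp
      then show ?thesis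
        using False u(1) permutes_not_in[OF G_permutes] by (simp add: U_def)
    qed
  qed
  moreover have "id \<in> ?K g" if g: "g \<in> carrier G" for g
  proof -
    have "g \<circ> (id \<circ> inv' g) = id" using permutes_inv_o(1)[OF G_permutes[OF g]] by simp
    moreover have "id \<in> U" using subgroup.one_closed[OF subgroup_U] by simp
    ultimately show ?thesis using inv_G[OF g] by (intro CollectI exI[of _ id]) simp
  qed
  ultimately show ?thesis unfolding core_free_def by auto
qed

section \<open>Right cosets as darts, double cosets as vertices\<close>

text \<open>Orbit-stabiliser correspondence: members of the coset are \<open>g \<circ> u\<close>
  with u fixing \<open>d\<^sub>0\<close>, and if x and g agree at \<open>d\<^sub>0\<close>, then
  \<open>inv' g \<circ> x\<close> is such a u.\<close>

lemma rcoset_U: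
  assumes g: "g \<in> carrier G"
  shows "U #>\<^bsub>G\<^esub> g = C (g d\<^sub>0)"
proof (intro equalityI subsetI)
  fix x assume "x \<in> U #>\<^bsub>G\<^esub> g"
  then obtain u where "u \<in> U" "x = g \<circ> u" by (auto simp: r_coset_def)
  then show "x \<in> C (g d\<^sub>0)" using comp_closed[OF _ g] by (simp add: U_def C_def)
next
  fix x assume x: "x \<in> C (g d\<^sub>0)"
  have p: "g permutes D" using G_permutes g by blast
  have "inv' g \<circ> x \<in> U"
    using x comp_closed[OF _ inv_closed[OF g]] permutes_inverses(2)[OF p] by (simp add: U_def C_def)
  moreover have "x = g \<circ> (inv' g \<circ> x)" using permutes_inv_o(1)[OF p] by (simp add: o_assoc)
  ultimately show "x \<in> U #>\<^bsub>G\<^esub> g" by (auto simp: r_coset_def)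
qed

text \<open>Membership in \<open>G\<close> is carried through the induction so that images of darts
  are again darts. The orbits of \<rho> are fibres of \<open>vt\<close>, which settles \<rho>; for
  its inverse, \<rho> is applied at the preimage of d.\<close>

lemma H_preserves_vt: "h \<in> H \<Longrightarrow> h \<in> carrier G \<and> (\<forall>d \<in> D. vt (h d) = vt d)"
proof (induction rule: generate.induct)
  case one
  show ?case using monoid.one_closed[OF group.is_monoid[OF group_G]] by (simp del: id_apply) simp
next
  case (incl h)
  have "vt (\<rho> d) = vt d" if "d \<in> D" for d
    using \<rho>_orbit[OF that] rangeI[of "\<lambda>k. (\<rho> ^^ k) d" 1] by simp
  then show ?case using incl gens by simp
next
  case (inv h)
  have "vt (inv' \<rho> d) = vt d" if "d \<in> D" for d
  proof -
    have "inv' \<rho> d \<in> D" using permutes_in_image[OF permutes_inv[OF \<rho>]] that by simp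
    moreover have "\<rho> (inv' \<rho> d) = d" using permutes_inverses(1)[OF \<rho>] .
    ultimately show ?thesis
      using \<rho>_orbit[of "inv' \<rho> d"] rangeI[of "\<lambda>k. (\<rho> ^^ k) (inv' \<rho> d)" 1] by simp
  qed
  then show ?case using inv gens inv_G inv_closed by simp
next
  case (eng g h)
  then have "h \<circ> g \<in> carrier G" using comp_closed by blast
  then show ?case using eng permutes_in_image[OF G_permutes] by (simp add: comp_def)
qed

lemma power_in_H: "\<rho> ^^ k \<in> H"
proof (induction k)
  case 0
  then show ?case using generate.one[of G "{\<rho>}"] by (simp add: id_def)
next
  case (Suc k)
  show ?case using generate.eng[OF Suc generate.incl, of \<rho>] by (simp add: comp_def)
qed

text \<open>Right multiplication by \<open>H\<close> only moves the image of
  \<open>d\<^sub>0\<close> around its vertex. Conversely, a power of \<rho> that takes d to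
  \<open>x d\<^sub>0\<close> can be split off from x.\<close>

lemma coset_H:
  assumes d: "d \<in> D"
  shows "C d <#>\<^bsub>G\<^esub> H = \<phi> (vt d)"
proof (intro equalityI subsetI)
  fix x assume "x \<in> C d <#>\<^bsub>G\<^esub> H"
  then obtain g h where "g \<in> C d" "h \<in> H" "x = h \<circ> g" by (auto simp: set_mult_def)
  then show "x \<in> \<phi> (vt d)" using H_preserves_vt[of h] comp_closed d by (simp add: C_def \<phi>_def)
next
  fix x assume x: "x \<in> \<phi> (vt d)"
  have xG: "x \<in> carrier G" and "vt (x d\<^sub>0) = vt d" using x by (simp_all add: \<phi>_def)
  moreover have "x d\<^sub>0 \<in> D" using permutes_in_image[OF G_permutes[OF xG]] d\<^sub>0 by simp
  ultimately obtain k where k: "x d\<^sub>0 = (\<rho> ^^ k) d" using \<rho>_orbit[OF d] by blast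
  let ?h = "\<rho> ^^ k"
  have h: "?h \<in> carrier G" "?h permutes D" using H_preserves_vt[OF power_in_H] G_permutes by blast+
  have "inv' ?h \<circ> x \<in> C d"
    using comp_closed[OF xG inv_closed[OF h(1)]] k permutes_inverses(2)[OF h(2)] by (simp add: C_def)
  moreover have "x = ?h \<circ> (inv' ?h \<circ> x)" using permutes_inv_o(1)[OF h(2)] by (simp add: o_assoc)
  ultimately show "x \<in> C d <#>\<^bsub>G\<^esub> H" using power_in_H unfolding set_mult_def by fastforce
qed

lemma C_nonempty: "d \<in> D \<Longrightarrow> C d \<noteq> {}"
  using G_transitive[of d] by (auto simp: C_def)

text \<open>Transitivity makes \<open>C d\<close> nonempty, and each member recovers d as the image
  of \<open>d\<^sub>0\<close>.\<close>

lemma inj_C: "inj_on C D"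
proof (rule inj_onI)
  fix d d' assume "d \<in> D" "d' \<in> D" "C d = C d'"
  then show "d = d'" using C_nonempty[of d] by (auto simp: C_def)
qed

lemma inj_\<phi>: "inj_on \<phi> (vt ` D)"
proof (rule inj_onI)
  fix v v' assume *: "v \<in> vt ` D" "v' \<in> vt ` D" "\<phi> v = \<phi> v'"
  then obtain d where d: "d \<in> D" "v = vt d" by blast
  then obtain g where "g \<in> carrier G" "g d\<^sub>0 = d" using G_transitive by blast
  then have "g \<in> \<phi> v" using d by (simp add: \<phi>_def)
  then have "g \<in> \<phi> v'" using * by simp
  then show "v = v'" using \<open>g \<in> \<phi> v\<close> by (simp add: \<phi>_def)
qed

section \<open>The isomorphism onto the monodromy graph\<close>

lemma orbit_of_d\<^sub>0: "(\<lambda>g. g d\<^sub>0) ` carrier G = D"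
proof (intro equalityI subsetI)
  fix d assume "d \<in> D"
  then show "d \<in> (\<lambda>g. g d\<^sub>0) ` carrier G" by (rule G_transitive) blast
qed (use permutes_in_image[OF G_permutes] d\<^sub>0 in auto)

text \<open>An edge goes to the set of right cosets of its darts, which is an edge of the monodromy
  graph because the darts of an edge form a \<tau>-orbit.\<close>

lemma isomorphic_mon_graph:
  fixes \<Sigma> :: "('v, 'e) graph"
  assumes S: "right_transversal G U S"
    and verts: "verts \<Sigma> = vt ` D" and edges: "edges \<Sigma> = eg ` D"
    and ends: "\<And>e. e \<in> edges \<Sigma> \<Longrightarrow> ends \<Sigma> e = image_mset vt (mset_set {d \<in> D. eg d = e})"
  shows "isomorphic_graphs \<Sigma> (mon_graph G U \<rho> \<tau> S)"
proof -
  interpret Mon: mon_setup G U S \<rho> \<tau>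
    by (intro mon_setup.intro mon_setup_axioms.intro group_G subgroup_U gens S) (simp add: \<tau>\<tau>)
  define F where "F e = {d \<in> D. eg d = e}" for e
  define \<psi> where "\<psi> e = C ` F e" for e
  have dc: "double_coset G U H g = \<phi> (vt (g d\<^sub>0))" if "g \<in> carrier G" for g
    using that rcoset_U[OF that] coset_H[of "g d\<^sub>0"] orbit_of_d\<^sub>0 by (auto simp: double_coset_def)
  have "verts Mon.M = (\<lambda>g. \<phi> (vt (g d\<^sub>0))) ` carrier G"
    using dc by (simp add: mon_graph_def Let_def cong: image_cong)
    also have "\<dots> = \<phi> ` vt ` (\<lambda>g. g d\<^sub>0) ` carrier G" by (simp only: image_image)
    also have "\<dots> = \<phi> ` verts \<Sigma>" unfolding orbit_of_d\<^sub>0 verts ..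
  finally have "bij_betw \<phi> (verts \<Sigma>) (verts Mon.M)"
    using inj_\<phi> verts by (simp add: bij_betw_def)
  moreover have "bij_betw \<psi> (edges \<Sigma>) (edges Mon.M)"
  proof -
    have "mon_edge G U \<tau> g = \<psi> (eg (g d\<^sub>0))" if g: "g \<in> carrier G" for g
    proof -
      have "g d\<^sub>0 \<in> D" using orbit_of_d\<^sub>0 g by blast
      have "mon_edge G U \<tau> g = C ` {g d\<^sub>0, \<tau> (g d\<^sub>0)}"
        using rcoset_U[OF g] rcoset_U[OF comp_closed[OF g gens(3)]] by (simp add: mon_edge_def)
      then show ?thesis unfolding \<tau>_orbit[OF \<open>g d\<^sub>0 \<in> D\<close>] \<psi>_def F_def .
    qed
    then have "edges Mon.M = (\<lambda>g. \<psi> (eg (g d\<^sub>0))) ` carrier G"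
      by (simp add: Mon.edges_eq cong: image_cong)
    also have "\<dots> = \<psi> ` eg ` (\<lambda>g. g d\<^sub>0) ` carrier G" by (simp only: image_image)
    also have "\<dots> = \<psi> ` edges \<Sigma>" unfolding orbit_of_d\<^sub>0 edges ..
    finally have "edges Mon.M = \<psi> ` edges \<Sigma>" .
    moreover have "inj_on \<psi> (edges \<Sigma>)"
    proof (rule inj_onI)
      fix e e' assume e: "e \<in> edges \<Sigma>" "e' \<in> edges \<Sigma>" "\<psi> e = \<psi> e'"
      have "F e = F e'"
        using e(3) inj_on_image_eq_iff[OF inj_C, of "F e" "F e'"] by (simp add: \<psi>_def F_def)
      moreover have "F e \<noteq> {}" using e(1) edges by (auto simp: F_def)
      ultimately show "e = e'" by (auto simp: F_def)
    qed
    ultimately show ?thesis by (simp add: bij_betw_def)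
  qed
  moreover have "ends Mon.M (\<psi> e) = image_mset \<phi> (ends \<Sigma> e)" if e: "e \<in> edges \<Sigma>" for e
  proof -
    obtain d where d: "d \<in> D" "e = eg d" using e edges by blast
    have "F e = {d, \<tau> d}" using \<tau>_orbit[OF d(1)] d(2) by (simp add: F_def)
    then have fin: "finite (F e)" by simp
    have "ends Mon.M (\<psi> e) = image_mset (\<lambda>X. X <#>\<^bsub>G\<^esub> H) (mset_set (C ` F e))"
      by (simp add: mon_graph_def Let_def \<psi>_def)
    \<comment> \<open>Injectivity of \<open>C\<close> keeps the darts of an edge apart as cosets, so
      a loop still has two ends.\<close>
    also have "mset_set (C ` F e) = image_mset C (mset_set (F e))"
      using inj_on_subset[OF inj_C, of "F e"] by (intro image_mset_mset_set[symmetric]) (auto simp: F_def)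
    also have "image_mset (\<lambda>X. X <#>\<^bsub>G\<^esub> H) \<dots> = image_mset (\<lambda>d. \<phi> (vt d)) (mset_set (F e))"
      using coset_H fin
      by (simp add: multiset.map_comp) (intro image_mset_cong, auto simp: F_def)
    finally show ?thesis using ends[OF e] by (simp add: multiset.map_comp F_def comp_def)
  qed
  ultimately show ?thesis unfolding isomorphic_graphs_def by blast
qed

end

section \<open>The darts of a graph\<close>

text \<open>A dart is an edge with a position in a list of its ends, so a loop gets two darts at one
  vertex. Numbering these pairs by naturals lets the group act on \<open>nat\<close> whatever the
  types of vertices and edges.\<close>

lemma ex_darts:
  fixes \<Sigma> :: "('v, 'e) graph"
  assumes fin: "finite (edges \<Sigma>)"
  obtains D :: "nat set" and vt :: "nat \<Rightarrow> 'v" and eg :: "nat \<Rightarrow> 'e" where "finite D"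
    and "eg ` D \<subseteq> edges \<Sigma>"
    and "\<And>e. e \<in> edges \<Sigma> \<Longrightarrow> ends \<Sigma> e = image_mset vt (mset_set {d \<in> D. eg d = e})"
proof -
  have "\<forall>e. \<exists>xs. mset xs = ends \<Sigma> e" using ex_mset by blast
  then obtain xs where xs: "\<And>e. mset (xs e) = ends \<Sigma> e" by metis
  define P where "P = Sigma (edges \<Sigma>) (\<lambda>e. {0..<length (xs e)})"
  have "finite P" using fin by (simp add: P_def)
  then obtain b where b: "bij_betw b {0..<card P} P" using ex_bij_betw_nat_finite by blast
  let ?D = "{0..<card P}" and ?vt = "\<lambda>d. xs (fst (b d)) ! snd (b d)" and ?eg = "\<lambda>d. fst (b d)"
  have "ends \<Sigma> e = image_mset ?vt (mset_set {d \<in> ?D. ?eg d = e})" if e: "e \<in> edges \<Sigma>" for e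
  proof -
    let ?F = "{d \<in> ?D. ?eg d = e}" and ?I = "{0..<length (xs e)}"
    have "b ` ?F = {p \<in> b ` ?D. fst p = e}" by blast
    also have "\<dots> = {p \<in> P. fst p = e}" using bij_betw_imp_surj_on[OF b] by simp
    also have "\<dots> = Pair e ` ?I" using e by (auto simp: P_def)
    finally have im: "b ` ?F = Pair e ` ?I" .
    have "snd ` b ` ?F = ?I" unfolding im by (simp add: image_image)
    moreover have "inj_on (snd \<circ> b) ?F"
    proof (rule comp_inj_on)
      show "inj_on b ?F" by (rule inj_on_subset[OF bij_betw_imp_inj_on[OF b]]) blast
      show "inj_on snd (b ` ?F)" unfolding im by (auto simp: inj_on_def)
    qed
    \<comment> \<open>Within one edge the position determines the dart, so running through its darts
      is running through its list of ends.\<close>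
    ultimately have I: "image_mset (snd \<circ> b) (mset_set ?F) = mset_set ?I"
      by (subst image_mset_mset_set) (simp_all add: image_comp)
    have "image_mset ?vt (mset_set ?F) = image_mset (\<lambda>d. xs e ! (snd \<circ> b) d) (mset_set ?F)"
      by (intro image_mset_cong) simp
    also have "\<dots> = image_mset ((!) (xs e)) (mset_set ?I)"
      unfolding I[symmetric] by (simp add: multiset.map_comp comp_def)
    also have "\<dots> = mset (map ((!) (xs e)) [0..<length (xs e)])" by simp
    also have "\<dots> = ends \<Sigma> e" by (simp add: map_nth xs)
    finally show ?thesis by simp
  qed
  moreover have "?eg ` ?D \<subseteq> edges \<Sigma>" using bij_betw_apply[OF b] by (force simp: P_def)
  ultimately show ?thesis using that[of ?D ?eg ?vt] by simp
qed

text \<open>Some edge has an end u; a path from u to v is trivial, so that v is this end, or its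
  last edge ends at v.\<close>

lemma vertex_has_edge:
  assumes wf: "wf_graph \<Sigma>" and con: "connected_graph \<Sigma>" and ne: "edges \<Sigma> \<noteq> {}"
    and v: "v \<in> verts \<Sigma>"
  shows "\<exists>e \<in> edges \<Sigma>. v \<in># ends \<Sigma> e"
proof -
  obtain e where e: "e \<in> edges \<Sigma>" using ne by blast
  then have "size (ends \<Sigma> e) \<in> {1, 2}" "set_mset (ends \<Sigma> e) \<subseteq> verts \<Sigma>"
    using wf unfolding wf_graph_def by blast+
  moreover from this(1) have "ends \<Sigma> e \<noteq> {#}" by auto
  ultimately obtain u where u: "u \<in># ends \<Sigma> e" "u \<in> verts \<Sigma>" by (metis multiset_nonemptyE subsetD)
  then have "(u, v) \<in> (adjacency \<Sigma>)\<^sup>*" using con v unfolding connected_graph_def by blast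
  then show ?thesis
  proof (cases rule: rtranclE)
    case base
    then show ?thesis using e u by blast
  next
    case (step w)
    then obtain e' where "e' \<in> edges \<Sigma>" "ends \<Sigma> e' = {#w, v#}" by (auto simp: adjacency_def)
    then show ?thesis by (intro bexI[of _ e']) simp_all
  qed
qed

theorem theorem3p9:
  fixes \<Sigma> :: "('v, 'e) graph"
  assumes "wf_graph \<Sigma>" and "finite_graph \<Sigma>" and "connected_graph \<Sigma>"
    and "edges \<Sigma> \<noteq> {}"
  shows "\<exists>(G :: (nat \<Rightarrow> nat) monoid) U \<rho> \<tau> S.
           group G \<and> \<rho> \<in> carrier G \<and> \<tau> \<in> carrier G \<and>
           carrier G = generate G {\<rho>, \<tau>} \<and> \<tau> \<otimes>\<^bsub>G\<^esub> \<tau> = \<one>\<^bsub>G\<^esub> \<and>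
           subgroup U G \<and> core_free G U \<and> right_transversal G U S \<and>
           isomorphic_graphs \<Sigma> (mon_graph G U \<rho> \<tau> S)"
proof -
  have "finite (edges \<Sigma>)" using assms(2) by (simp add: finite_graph_def)
  then obtain D :: "nat set" and vt :: "nat \<Rightarrow> 'v" and eg :: "nat \<Rightarrow> 'e"
    where D: "finite D" and eg: "eg ` D \<subseteq> edges \<Sigma>"
      and ends: "\<And>e. e \<in> edges \<Sigma> \<Longrightarrow> ends \<Sigma> e = image_mset vt (mset_set {d \<in> D. eg d = e})"
    using ex_darts[of \<Sigma>] by metis
  have mem: "x \<in># ends \<Sigma> e \<longleftrightarrow> (\<exists>d \<in> D. eg d = e \<and> vt d = x)" if "e \<in> edges \<Sigma>" for x e
    using ends[OF that] D by auto
  have size: "size (ends \<Sigma> e) \<in> {1, 2}" "set_mset (ends \<Sigma> e) \<subseteq> verts \<Sigma>" if "e \<in> edges \<Sigma>" for e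
    using assms(1) that unfolding wf_graph_def by blast+
  have verts: "verts \<Sigma> = vt ` D"
  proof
    show "verts \<Sigma> \<subseteq> vt ` D"
    proof
      fix v assume "v \<in> verts \<Sigma>"
      then obtain e where "e \<in> edges \<Sigma>" "v \<in># ends \<Sigma> e"
        using vertex_has_edge[OF assms(1,3,4)] by blast
      then show "v \<in> vt ` D" using mem[of e v] by auto
    qed
    show "vt ` D \<subseteq> verts \<Sigma>"
    proof
      fix v assume "v \<in> vt ` D"
      then obtain d where d: "d \<in> D" "v = vt d" by blast
      then have "eg d \<in> edges \<Sigma>" using eg by blast
      then show "v \<in> verts \<Sigma>" using mem[of "eg d" v] size(2)[of "eg d"] d by blast
    qed
  qed
  have edges: "edges \<Sigma> = eg ` D"
  proof
    show "edges \<Sigma> \<subseteq> eg ` D"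
    proof
      fix e assume e: "e \<in> edges \<Sigma>"
      then have "ends \<Sigma> e \<noteq> {#}" using size(1)[OF e] by auto
      then obtain x where "x \<in># ends \<Sigma> e" by (rule multiset_nonemptyE)
      then show "e \<in> eg ` D" using mem[OF e, of x] by auto
    qed
  qed (rule eg)
  obtain \<rho> where \<rho>: "\<rho> permutes D"
    "\<And>d. d \<in> D \<Longrightarrow> range (\<lambda>k. (\<rho> ^^ k) d) = {d' \<in> D. vt d' = vt d}"
    using cyclic_permutation_of_fibres[OF D, of vt] by blast
  obtain \<tau> where \<tau>: "\<tau> permutes D"
    "\<And>d. d \<in> D \<Longrightarrow> range (\<lambda>k. (\<tau> ^^ k) d) = {d' \<in> D. eg d' = eg d}"
    using cyclic_permutation_of_fibres[OF D, of eg] by blast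
  have \<tau>_orbit: "{d, \<tau> d} = {d' \<in> D. eg d' = eg d}" if d: "d \<in> D" for d
  proof -
    let ?F = "{d' \<in> D. eg d' = eg d}"
    \<comment> \<open>An edge has as many darts as ends, hence at most two. If \<tau> moves d, the
      pair fills the fibre; if it fixes d, the orbit, and so the fibre, is just d.\<close>
    have "card ?F = size (ends \<Sigma> (eg d))" using ends edges d by simp
    then have card: "card ?F \<le> 2" using size(1)[of "eg d"] edges d by auto
    have sub: "{d, \<tau> d} \<subseteq> ?F" using \<tau>(2)[OF d] rangeI[of "\<lambda>k. (\<tau> ^^ k) d" 1] d by auto
    show ?thesis
    proof (cases "\<tau> d = d")
      case True
      then have "(\<tau> ^^ k) d = d" for k by (induction k) simp_all
      then show ?thesis using \<tau>(2)[OF d] True by auto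
    next
      case False
      then show ?thesis using sub card D by (intro card_seteq) auto
    qed
  qed
  have \<tau>\<tau>: "\<tau> \<circ> \<tau> = id"
  proof
    fix d show "(\<tau> \<circ> \<tau>) d = id d"
    proof (cases "d \<in> D")
      case True
      then have "\<tau> d \<in> D" "eg (\<tau> d) = eg d" using \<tau>_orbit[OF True] by blast+
      \<comment> \<open>Both d and \<tau> d lie on the same edge, so their orbits agree; comparing
        the two pairs returns \<tau> d to d.\<close>
      then have "{\<tau> d, \<tau> (\<tau> d)} = {d, \<tau> d}" using \<tau>_orbit[OF True] \<tau>_orbit[of "\<tau> d"] by simp
      then show ?thesis by (auto simp: doubleton_eq_iff)
    qed (simp add: permutes_not_in[OF \<tau>(1)])
  qed
  obtain d\<^sub>0 where d\<^sub>0: "d\<^sub>0 \<in> D" using edges assms(4) by blast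
  have transitive: "D \<subseteq> X" if X: "d\<^sub>0 \<in> X" "\<And>d. d \<in> X \<Longrightarrow> \<rho> d \<in> X \<and> \<tau> d \<in> X" for X
  proof -
    \<comment> \<open>With one dart, \<open>X\<close> contains all darts at its vertex, since powers
      of \<rho> reach them; with \<tau> the same follows for the darts of its edge.\<close>
    have vtX: "d' \<in> X" if d: "d \<in> X" "d \<in> D" "d' \<in> D" "vt d' = vt d" for d d'
    proof -
      obtain k where "d' = (\<rho> ^^ k) d" using \<rho>(2)[OF d(2)] d(3,4) by blast
      moreover have "(\<rho> ^^ k) d \<in> X" using d(1) X(2) by (induction k) simp_all
      ultimately show ?thesis by simp
    qed
    have egX: "d' \<in> X" if d: "d \<in> X" "d \<in> D" "d' \<in> D" "eg d' = eg d" for d d'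
    proof -
      have "d' \<in> {d, \<tau> d}" unfolding \<tau>_orbit[OF d(2)] using d(3,4) by simp
      then show ?thesis using d(1) X(2)[OF d(1)] by blast
    qed
    \<comment> \<open>Along a walk, membership in \<open>X\<close> passes from a dart at u to the
      dart at u of the next edge, then across that edge to a dart at v.\<close>
    have reach: "\<exists>d \<in> D \<inter> X. vt d = v" if "(vt d\<^sub>0, v) \<in> (adjacency \<Sigma>)\<^sup>*" for v
      using that
    proof (induction rule: rtrancl_induct)
      case base
      then show ?case using X(1) d\<^sub>0 by blast
    next
      case (step u v)
      then obtain e where e: "e \<in> edges \<Sigma>" "ends \<Sigma> e = {#u, v#}" by (auto simp: adjacency_def)
      then obtain d d' where d: "d \<in> D" "eg d = e" "vt d = u" "d' \<in> D" "eg d' = e" "vt d' = v"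
        using mem[OF e(1), of u] mem[OF e(1), of v] by auto
      moreover have "d \<in> X" using step.IH vtX[of _ d] d by blast
      ultimately show ?case using egX[of d d'] by blast
    qed
    show ?thesis
    proof
      fix d assume d: "d \<in> D"
      then have "(vt d\<^sub>0, vt d) \<in> (adjacency \<Sigma>)\<^sup>*"
        using assms(3) d\<^sub>0 verts unfolding connected_graph_def by blast
      then obtain d' where "d' \<in> D" "d' \<in> X" "vt d' = vt d" using reach by blast
      then show "d \<in> X" using vtX[of d' d] d by simp
    qed
  qed
  interpret dart_system D \<rho> \<tau> d\<^sub>0 vt eg
    by (intro dart_system.intro \<rho> \<tau>(1) \<tau>\<tau> d\<^sub>0 \<tau>_orbit transitive)
  obtain S where S: "right_transversal G U S"
    using group.ex_right_transversal[OF group_G subgroup_U] by blast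
  have "\<tau> \<otimes>\<^bsub>G\<^esub> \<tau> = \<one>\<^bsub>G\<^esub>" using \<tau>\<tau> by simp
  then show ?thesis
    using group_G gens(2,3) carrier_G subgroup_U core_free_U S isomorphic_mon_graph[OF S verts edges ends]
    by (intro exI conjI)
qed

end
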